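(* Let $\pi,\tau\in S_n$, $\pi\ne\tau$, and let $E^n_{\pi,\tau}$ be a real evolution algebra of permutations satisfying: (1) $a_{i\pi(i)}\cdot a_{i\tau(i)}\neq0$ for $1\le i\le n$; (2) $\pi=\pi_1\circ\pi_2\circ\dots\circ\pi_r$ and $\tau=\tau_1\circ\tau_2\circ\dots\circ\tau_r$, where $\pi_i=(\pi_{i1}\ \pi_{i2}\ \dots\ \pi_{ik_i})$ and $\tau_i=(\tau_{i1}\ \tau_{i2}\ \dots\ \tau_{ik_i})$, $1\le i\le r$, are the independent cycles of $\pi$ and of $\tau$ respectively (cycles of length one included), and $k_1+k_2+\dots+k_r=n$. If $\tau_{im}\in\{\pi_{i1},\pi_{i2},\dots,\pi_{ik_i}\}$ for all $1\le i\le r$, $1\le m\le k_i$ (i.e. the cycles $\pi_i$ and $\tau_i$ consist of the same elements, possibly in a different order), then $$E^n_{\pi,\tau}\cong E^{k_1}_{\pi_1,\tau_1}\oplus E^{k_2}_{\pi_2,\tau_2}\oplus\dots\oplus E^{k_r}_{\pi_r,\tau_r}.$$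
   Context: For $\pi,\tau\in S_n$, $E^n_{\pi,\tau}$ denotes the $n$-dimensional algebra over $\mathbb{R}$ with basis $e_1,\dots,e_n$ and multiplication $e_i\cdot e_j=0$ for $i\neq j$, and $e_i\cdot e_i=a_{i\pi(i)}e_{\pi(i)}+a_{i\tau(i)}e_{\tau(i)}$ for every $i$, with real $a_{i\pi(i)},a_{i\tau(i)}$ (if $\pi(i)=\tau(i)$ this is a single number and $e_i\cdot e_i=2a_{i\pi(i)}e_{\pi(i)}$). The algebra $E^{k_i}_{\pi_i,\tau_i}$ is the $k_i$-dimensional evolution algebra with basis indexed by $\{\pi_{i1},\dots,\pi_{ik_i}\}$, say $e_{\pi_{i1}},\dots,e_{\pi_{ik_i}}$, and multiplication $e_{\pi_{im}}\cdot e_{\pi_{im}}=a_{\pi_{im}\pi(\pi_{im})}e_{\pi(\pi_{im})}+a_{\pi_{im}\tau(\pi_{im})}e_{\tau(\pi_{im})}$, $e_{\pi_{im}}\cdot e_{\pi_{ik}}=0$ for $m\ne k$, with the same constants $a$ as in $E^n_{\pi,\tau}$ (the cycles $\pi_i$ and $\tau_i$ of the same index $i$ are allowed to coincide). The direct sum is the direct sum of algebras with componentwise multiplication. *)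

theory Defs
  imports Complex_Main "HOL-Combinatorics.Cycles"
begin

text \<open>Real algebras need be neither associative nor unital here, so the ring and algebra
  structures of HOL-Algebra do not apply.\<close>

record 'v real_algebra =
  alg_carrier :: "'v set"
  alg_add :: "'v \<Rightarrow> 'v \<Rightarrow> 'v"
  alg_scale :: "real \<Rightarrow> 'v \<Rightarrow> 'v"
  alg_mult :: "'v \<Rightarrow> 'v \<Rightarrow> 'v"

definition alg_isomorphism ::
    "'v real_algebra \<Rightarrow> 'w real_algebra \<Rightarrow> ('v \<Rightarrow> 'w) \<Rightarrow> bool" where
  "alg_isomorphism A B f \<longleftrightarrow>
     bij_betw f (alg_carrier A) (alg_carrier B) \<and>
     (\<forall>x\<in>alg_carrier A. \<forall>y\<in>alg_carrier A. f (alg_add A x y) = alg_add B (f x) (f y)) \<and>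
     (\<forall>c. \<forall>x\<in>alg_carrier A. f (alg_scale A c x) = alg_scale B c (f x)) \<and>
     (\<forall>x\<in>alg_carrier A. \<forall>y\<in>alg_carrier A. f (alg_mult A x y) = alg_mult B (f x) (f y))"

definition alg_isomorphic :: "'v real_algebra \<Rightarrow> 'w real_algebra \<Rightarrow> bool" where
  "alg_isomorphic A B \<longleftrightarrow> (\<exists>f. alg_isomorphism A B f)"

definition alg_direct_sum ::
    "'i set \<Rightarrow> ('i \<Rightarrow> 'v real_algebra) \<Rightarrow> ('i \<Rightarrow> 'v) real_algebra" where
  "alg_direct_sum I A =
     \<lparr> alg_carrier = (\<Pi>\<^sub>E i\<in>I. alg_carrier (A i)),
       alg_add = (\<lambda>x y. \<lambda>i\<in>I. alg_add (A i) (x i) (y i)),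
       alg_scale = (\<lambda>c x. \<lambda>i\<in>I. alg_scale (A i) c (x i)),
       alg_mult = (\<lambda>x y. \<lambda>i\<in>I. alg_mult (A i) (x i) (y i)) \<rparr>"

definition basis_vec :: "'a \<Rightarrow> 'a \<Rightarrow> real" where
  "basis_vec i = (\<lambda>j. if j = i then 1 else 0)"

text \<open>The algebra with basis \<open>(e\<^sub>i)\<close>, \<open>i \<in> S\<close>, for a finite set \<open>S\<close> mapped to itself by \<open>p\<close> and
  \<open>q\<close>. A vector is its coordinate function, extended by zero outside \<open>S\<close>; the multiplication is
  the bilinear extension of \<open>e\<^sub>i \<cdot> e\<^sub>j = 0\<close> for \<open>i \<noteq> j\<close> and
  \<open>e\<^sub>i \<cdot> e\<^sub>i = a i (p i) e\<^bsub>p i\<^esub> + a i (q i) e\<^bsub>q i\<^esub>\<close>.\<close>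

definition evol_alg ::
    "'a set \<Rightarrow> ('a \<Rightarrow> 'a) \<Rightarrow> ('a \<Rightarrow> 'a) \<Rightarrow> ('a \<Rightarrow> 'a \<Rightarrow> real) \<Rightarrow> ('a \<Rightarrow> real) real_algebra" where
  "evol_alg S p q a =
     \<lparr> alg_carrier = {x. \<forall>j. j \<notin> S \<longrightarrow> x j = 0},
       alg_add = (\<lambda>x y j. x j + y j),
       alg_scale = (\<lambda>c x j. c * x j),
       alg_mult = (\<lambda>x y j. \<Sum>i\<in>S. x i * y i *
         (a i (p i) * basis_vec (p i) j + a i (q i) * basis_vec (q i) j)) \<rparr>"

text \<open>\<open>cs\<close> lists the independent cycles of \<open>p\<close> on \<open>S\<close>, fixed points included as cycles of
  length one; the list \<open>[x\<^sub>1, \<dots>, x\<^sub>k]\<close> stands for the cycle \<open>(x\<^sub>1 \<dots> x\<^sub>k)\<close>. Distinctness of the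
  concatenation says that each cycle has distinct entries and that the cycles are disjoint.\<close>

definition independent_cycles :: "'a set \<Rightarrow> ('a \<Rightarrow> 'a) \<Rightarrow> 'a list list \<Rightarrow> bool" where
  "independent_cycles S p cs \<longleftrightarrow>
     [] \<notin> set cs \<and> distinct (concat cs) \<and> set (concat cs) = S \<and>
     p = foldr (\<circ>) (map cycle_of_list cs) id"

lemma evol_alg_basis_vec_mult:
  assumes "finite S" "i \<in> S" "j \<in> S"
  shows "alg_mult (evol_alg S p q a) (basis_vec i) (basis_vec j) =
    (if i = j then \<lambda>k. a i (p i) * basis_vec (p i) k + a i (q i) * basis_vec (q i) k
     else (\<lambda>k. 0))"
proof
  fix k
  let ?w = "\<lambda>l. a l (p l) * basis_vec (p l) k + a l (q l) * basis_vec (q l) k"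
  have "alg_mult (evol_alg S p q a) (basis_vec i) (basis_vec j) k =
      (\<Sum>l\<in>S. if l = i then (if i = j then ?w i else 0) else 0)"
    unfolding evol_alg_def real_algebra.simps
    by (rule sum.cong) (simp_all add: basis_vec_def)
  then show "alg_mult (evol_alg S p q a) (basis_vec i) (basis_vec j) k =
    (if i = j then \<lambda>k. a i (p i) * basis_vec (p i) k + a i (q i) * basis_vec (q i) k
     else (\<lambda>k. 0)) k"
    using assms by simp
qed

lemma evol_alg_basis_vec_carrier:
  "i \<in> S \<Longrightarrow> basis_vec i \<in> alg_carrier (evol_alg S p q a)"
  by (auto simp: evol_alg_def basis_vec_def)

lemma evol_alg_expansion:
  assumes "finite S" "x \<in> alg_carrier (evol_alg S p q a)"
  shows "x = (\<lambda>j. \<Sum>i\<in>S. x i * basis_vec i j)"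
proof
  fix j
  have "(\<Sum>i\<in>S. x i * basis_vec i j) = (\<Sum>i\<in>S. if j = i then x i else 0)"
    by (intro sum.cong) (auto simp: basis_vec_def)
  then show "x j = (\<Sum>i\<in>S. x i * basis_vec i j)"
    using assms by (auto simp: evol_alg_def)
qed

lemma independent_cycles_apply:
  assumes "independent_cycles S p cs" "c \<in> set cs" "x \<in> set c"
  shows "cycle_of_list c x = p x"
proof -
  have outside: "foldr (\<circ>) (map cycle_of_list ds) id y = y" if "y \<notin> set (concat ds)"
    for ds :: "'a list list" and y
    using that by (induction ds) (auto simp: id_outside_supp)
  have "foldr (\<circ>) (map cycle_of_list ds) id x = cycle_of_list c x"
    if "distinct (concat ds)" "c \<in> set ds" for ds
    using that
  proof (induction ds)
    case (Cons d ds)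
    show ?case
    proof (cases "c \<in> set ds")
      case True
      have "cycle_of_list c x \<in> set c"
        using assms(3) permutes_in_image[OF cycle_permutes[of c]] by blast
      then have "cycle_of_list c x \<notin> set d"
        using Cons.prems(1) True by auto
      then show ?thesis
        using Cons True by (simp add: id_outside_supp)
    next
      case False
      then have "c = d" using Cons.prems(2) by simp
      moreover have "x \<notin> set (concat ds)"
        using Cons.prems(1) assms(3) calculation by auto
      moreover have "foldr (\<circ>) (map cycle_of_list (d # ds)) id x =
          cycle_of_list d (foldr (\<circ>) (map cycle_of_list ds) id x)"
        by simp
      ultimately show ?thesis using outside[of x ds] by metis
    qed
  qed simp
  then show ?thesis using assms by (simp add: independent_cycles_def)
qed

end

theory Submission
  imports Defs
begin

text \<open>If \<open>p\<close> and \<open>q\<close> both map a block \<open>B\<close> of basis indices into itself, then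
  squares of basis vectors of \<open>B\<close> stay in the span of \<open>B\<close>. Products of basis vectors from
  different blocks vanish in every evolution algebra. So for a partition into such blocks the
  spans are ideals that annihilate one another, and splitting a vector into its parts
  on the blocks is an isomorphism onto the direct sum (\<open>evol_alg_block_decomposition\<close>).

  In the theorem the blocks are the supports of the cycles of \<open>\<pi>\<close>, which \<open>\<pi>\<close> preserves. The
  \<open>i\<close>-th cycle of \<open>\<tau>\<close> has its entries in the \<open>i\<close>-th block and has the same length, so it
  has the same support and \<open>\<tau>\<close> preserves the block as well. On a block, \<open>\<pi>\<close> and \<open>\<tau>\<close> act as the
  single cycles that define the corresponding summand.\<close>

lemma evol_alg_cong:
  assumes "\<And>i. i \<in> S \<Longrightarrow> p i = p' i" and "\<And>i. i \<in> S \<Longrightarrow> q i = q' i"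
  shows "evol_alg S p q a = evol_alg S p' q' a"
  using assms by (simp add: evol_alg_def cong: sum.cong)

lemma alg_direct_sum_cong:
  assumes "\<And>i. i \<in> I \<Longrightarrow> A i = B i"
  shows "alg_direct_sum I A = alg_direct_sum I B"
  using assms by (simp add: alg_direct_sum_def cong: restrict_cong PiE_cong)

definition block_parts :: "'i set \<Rightarrow> ('i \<Rightarrow> 'a set) \<Rightarrow> ('a \<Rightarrow> real) \<Rightarrow> 'i \<Rightarrow> 'a \<Rightarrow> real" where
  "block_parts I B x = (\<lambda>l\<in>I. \<lambda>j. if j \<in> B l then x j else 0)"

text \<open>Each coordinate lies in exactly one block: covering makes the map injective, disjointness
  lets the parts be prescribed independently.\<close>

lemma bij_betw_block_parts:
  fixes a :: "'a \<Rightarrow> 'a \<Rightarrow> real"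
  assumes disj: "disjoint_family_on B I" and S: "S = (\<Union>l\<in>I. B l)"
  shows "bij_betw (block_parts I B) (alg_carrier (evol_alg S p q a))
    (alg_carrier (alg_direct_sum I (\<lambda>l. evol_alg (B l) p q a)))"
proof -
  obtain b where b: "b j \<in> I" "j \<in> B (b j)" if "j \<in> S" for j
  proof -
    have "\<forall>j\<in>S. \<exists>l. l \<in> I \<and> j \<in> B l"
      using S by blast
    from bchoice[OF this] show thesis
      using that by blast
  qed
  have b_eq: "b j = l" if "l \<in> I" "j \<in> B l" for l j
    using disj b[of j] that unfolding disjoint_family_on_def S by blast
  let ?g = "\<lambda>y j. if j \<in> S then y (b j) j else (0::real)"
  have "bij_betw (block_parts I B) {x. \<forall>j. j \<notin> S \<longrightarrow> x j = 0}
      (\<Pi>\<^sub>E l\<in>I. {x. \<forall>j. j \<notin> B l \<longrightarrow> x j = 0})"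
  proof (rule bij_betw_byWitness[where f' = ?g])
    show "\<forall>x\<in>{x. \<forall>j. j \<notin> S \<longrightarrow> x j = 0}. ?g (block_parts I B x) = x"
      using b by (auto simp: block_parts_def fun_eq_iff)
    show "\<forall>y\<in>\<Pi>\<^sub>E l\<in>I. {x. \<forall>j. j \<notin> B l \<longrightarrow> x j = 0}. block_parts I B (?g y) = y"
    proof
      fix y :: "'b \<Rightarrow> 'a \<Rightarrow> real"
      assume y: "y \<in> (\<Pi>\<^sub>E l\<in>I. {x. \<forall>j. j \<notin> B l \<longrightarrow> x j = 0})"
      show "block_parts I B (?g y) = y"
      proof
        fix l
        show "block_parts I B (?g y) l = y l"
        proof (cases "l \<in> I")
          case True
          then have "j \<in> S" "b j = l" if "j \<in> B l" for j
            using that b_eq S by auto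
          moreover have "y l j = 0" if "j \<notin> B l" for j
            using y True that by (auto dest: PiE_mem)
          ultimately show ?thesis
            using True by (auto simp: block_parts_def fun_eq_iff)
        next
          case False
          then show ?thesis
            using PiE_arb[OF y False] by (simp add: block_parts_def)
        qed
      qed
    qed
  qed (auto simp: block_parts_def)
  then show ?thesis
    by (simp add: evol_alg_def alg_direct_sum_def)
qed

text \<open>A coordinate \<open>j\<close> of the product receives contributions only from those \<open>i\<close> with
  \<open>p i = j\<close> or \<open>q i = j\<close>, and by invariance these lie in the block of \<open>j\<close>. Hence the full sum
  over \<open>S\<close> reduces to the sum over that block.\<close>

lemma block_parts_mult:
  assumes "finite S" and disj: "disjoint_family_on B I" and S: "S = (\<Union>l\<in>I. B l)"
    and p: "\<And>l i. l \<in> I \<Longrightarrow> i \<in> B l \<Longrightarrow> p i \<in> B l"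
    and q: "\<And>l i. l \<in> I \<Longrightarrow> i \<in> B l \<Longrightarrow> q i \<in> B l"
  shows "block_parts I B (alg_mult (evol_alg S p q a) x y) =
    alg_mult (alg_direct_sum I (\<lambda>l. evol_alg (B l) p q a)) (block_parts I B x) (block_parts I B y)"
proof -
  let ?w = "\<lambda>i j. a i (p i) * basis_vec (p i) j + a i (q i) * basis_vec (q i) j"
  let ?r = "\<lambda>l x j. if j \<in> B l then x j else (0::real)"
  have "?r l (\<lambda>j. \<Sum>i\<in>S. x i * y i * ?w i j) j = (\<Sum>i\<in>B l. ?r l x i * ?r l y i * ?w i j)"
    if l: "l \<in> I" for l j
  proof (cases "j \<in> B l")
    case True
    have "?w i j = 0" if i: "i \<in> S - B l" for i
    proof -
      obtain m where m: "m \<in> I" "i \<in> B m" "m \<noteq> l"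
        using i S by auto
      then have "j \<notin> B m"
        using disj l True unfolding disjoint_family_on_def by blast
      then show ?thesis
        using p[OF m(1,2)] q[OF m(1,2)] by (auto simp: basis_vec_def)
    qed
    then have "(\<Sum>i\<in>S. x i * y i * ?w i j) = (\<Sum>i\<in>B l. x i * y i * ?w i j)"
      using \<open>finite S\<close> l S by (intro sum.mono_neutral_right) auto
    then show ?thesis
      using True by simp
  next
    case False
    then have "?w i j = 0" if "i \<in> B l" for i
      using p[OF l that] q[OF l that] by (auto simp: basis_vec_def)
    then show ?thesis
      using False by simp
  qed
  then show ?thesis
    by (simp add: block_parts_def evol_alg_def alg_direct_sum_def fun_eq_iff restrict_def)
qed

theorem evol_alg_block_decomposition:
  assumes "finite S" and "disjoint_family_on B I" and "S = (\<Union>l\<in>I. B l)"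
    and "\<And>l i. l \<in> I \<Longrightarrow> i \<in> B l \<Longrightarrow> p i \<in> B l"
    and "\<And>l i. l \<in> I \<Longrightarrow> i \<in> B l \<Longrightarrow> q i \<in> B l"
  shows "alg_isomorphic (evol_alg S p q a) (alg_direct_sum I (\<lambda>l. evol_alg (B l) p q a))"
proof -
  let ?E = "evol_alg S p q a" and ?D = "alg_direct_sum I (\<lambda>l. evol_alg (B l) p q a)"
  have "block_parts I B (alg_add ?E x y) = alg_add ?D (block_parts I B x) (block_parts I B y)"
    "block_parts I B (alg_scale ?E c x) = alg_scale ?D c (block_parts I B x)" for c x y
    by (auto simp: block_parts_def evol_alg_def alg_direct_sum_def fun_eq_iff restrict_def)
  moreover have "block_parts I B (alg_mult ?E x y) =
      alg_mult ?D (block_parts I B x) (block_parts I B y)" for x y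
    using assms by (rule block_parts_mult)
  ultimately have "alg_isomorphism ?E ?D (block_parts I B)"
    unfolding alg_isomorphism_def
    using bij_betw_block_parts[OF assms(2,3)] by simp
  then show ?thesis
    unfolding alg_isomorphic_def by blast
qed

lemma independent_cycles_invariant:
  assumes "independent_cycles S p cs" and "c \<in> set cs" and "x \<in> set c"
  shows "p x \<in> set c"
proof -
  have "cycle_of_list c x \<in> set c"
    using assms(3) permutes_in_image[OF cycle_permutes[of c], of x] by blast
  then show ?thesis
    by (simp only: independent_cycles_apply[OF assms])
qed

lemma independent_cycles_disjoint:
  assumes "independent_cycles S p cs"
  shows "disjoint_family_on (\<lambda>i. set (cs ! i)) {..<length cs}"
proof -
  have "set (cs ! i) \<inter> set (cs ! j) = {}"
    if ij: "i < length cs" "j < length cs" "i \<noteq> j" for i j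
  proof -
    have "distinct (concat cs)" "[] \<notin> set cs"
      using assms by (auto simp: independent_cycles_def)
    \<comment> \<open>Only empty lists may repeat in a list with distinct concatenation, so distinct positions
      carry distinct cycles.\<close>
    then have "distinct cs"
      by (simp add: distinct_concat_iff)
    then have "cs ! i \<noteq> cs ! j"
      using ij by (simp add: nth_eq_iff_index_eq)
    then show ?thesis
      using \<open>distinct (concat cs)\<close> ij by (simp add: distinct_concat_iff)
  qed
  then show ?thesis
    by (simp add: disjoint_family_on_def)
qed

theorem theorem5:
  fixes n r :: nat
    and \<pi> \<tau> :: "nat \<Rightarrow> nat"
    and a :: "nat \<Rightarrow> nat \<Rightarrow> real"
    and k :: "nat \<Rightarrow> nat"
    and \<pi>s \<tau>s :: "nat list list"
  assumes "\<pi> permutes {1..n}" and "\<tau> permutes {1..n}" and "\<pi> \<noteq> \<tau>"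
    and "\<forall>i\<in>{1..n}. a i (\<pi> i) * a i (\<tau> i) \<noteq> 0"
    and "independent_cycles {1..n} \<pi> \<pi>s" and "independent_cycles {1..n} \<tau> \<tau>s"
    and "length \<pi>s = r" and "length \<tau>s = r"
    and "\<forall>i<r. length (\<pi>s ! i) = k i \<and> length (\<tau>s ! i) = k i"
    and "(\<Sum>i<r. k i) = n"
    and "\<forall>i<r. \<forall>m<k i. \<tau>s ! i ! m \<in> set (\<pi>s ! i)"
  shows "alg_isomorphic (evol_alg {1..n} \<pi> \<tau> a)
           (alg_direct_sum {..<r}
             (\<lambda>i. evol_alg (set (\<pi>s ! i)) (cycle_of_list (\<pi>s ! i)) (cycle_of_list (\<tau>s ! i)) a))"
proof -
  let ?B = "\<lambda>i. set (\<pi>s ! i)"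
  have same_support: "set (\<tau>s ! i) = ?B i" if i: "i < r" for i
  proof (rule card_subset_eq)
    show "set (\<tau>s ! i) \<subseteq> ?B i"
      using assms(9,11) i by (auto simp: in_set_conv_nth)
    have "distinct (\<pi>s ! i)" "distinct (\<tau>s ! i)"
      using assms(5-8) i by (auto simp: independent_cycles_def distinct_concat_iff)
    then show "card (set (\<tau>s ! i)) = card (?B i)"
      using assms(9) i by (simp add: distinct_card)
  qed simp
  have mem: "\<pi>s ! i \<in> set \<pi>s" "\<tau>s ! i \<in> set \<tau>s" if "i < r" for i
    using that assms(7,8) by auto
  have "{1..n} = (\<Union>i\<in>{..<r}. ?B i)"
  proof -
    have "{1..n} = \<Union> (set ` set \<pi>s)"
      using assms(5) by (simp add: independent_cycles_def)
    also have "set \<pi>s = (!) \<pi>s ` {..<r}"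
      using assms(7) by (auto simp: set_conv_nth)
    finally show ?thesis
      by (simp add: image_image)
  qed
  moreover have "disjoint_family_on ?B {..<r}"
    using independent_cycles_disjoint[OF assms(5)] assms(7) by simp
  moreover have "\<pi> x \<in> ?B i" "\<tau> x \<in> ?B i" if "i \<in> {..<r}" "x \<in> ?B i" for i x
    using that same_support[of i] mem[of i] independent_cycles_invariant[OF assms(5), of "\<pi>s ! i" x]
      independent_cycles_invariant[OF assms(6), of "\<tau>s ! i" x] by simp_all
  ultimately have "alg_isomorphic (evol_alg {1..n} \<pi> \<tau> a)
      (alg_direct_sum {..<r} (\<lambda>i. evol_alg (?B i) \<pi> \<tau> a))"
    by (intro evol_alg_block_decomposition) simp_all
  moreover have "alg_direct_sum {..<r} (\<lambda>i. evol_alg (?B i) \<pi> \<tau> a) =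
      alg_direct_sum {..<r}
        (\<lambda>i. evol_alg (?B i) (cycle_of_list (\<pi>s ! i)) (cycle_of_list (\<tau>s ! i)) a)"
  proof (intro alg_direct_sum_cong evol_alg_cong)
    fix i x
    assume "i \<in> {..<r}" "x \<in> ?B i"
    then show "\<pi> x = cycle_of_list (\<pi>s ! i) x" "\<tau> x = cycle_of_list (\<tau>s ! i) x"
      using mem[of i] same_support[of i] independent_cycles_apply[OF assms(5), of "\<pi>s ! i" x]
        independent_cycles_apply[OF assms(6), of "\<tau>s ! i" x] by simp_all
  qed
  ultimately show ?thesis
    by simp
qed

end
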